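(* Let $h\ge1$, let $m_1,\dots,m_h,n_1,\dots,n_h$ be positive integers, and let $G=\mathrm{NSG}(m_1,\ldots,m_h;n_1,\ldots,n_h)$. Suppose that for some $s\in\{1,\dots,h\}$ all vertices in $U_s$ are neutral vertices for an eigenvalue $\lambda\neq0,-1$ of $G$. Let $G''=\mathrm{NSG}(m_1,\ldots,m_s;n_1,\ldots,n_s)$ and $n''=|V(G'')|=\sum_{i=1}^s(m_i+n_i)$. Then $$\lambda_{n''}(G'')<\lambda<\lambda_1(G''),$$ where $\lambda_1(G'')$ and $\lambda_{n''}(G'')$ are the largest and smallest eigenvalues of $G''$.
   Context: All graphs are simple; eigenvalues of a graph are those of its adjacency matrix, listed in non-increasing order. The nested split (threshold) graph $\mathrm{NSG}(m_1,\ldots,m_h;n_1,\ldots,n_h)$ has vertex set the disjoint union of sets $U_1,\dots,U_h,V_1,\dots,V_h$ with $|U_i|=m_i$, $|V_i|=n_i$; the set $V=\bigcup_i V_i$ induces a clique, the set $U=\bigcup_i U_i$ induces a co-clique, and a vertex $u\in U_i$ is adjacent to a vertex $v\in V_j$ if and only if $j\le i$. For an eigenvalue $\lambda$ of a graph $G$ of multiplicity $k\ge1$ and a vertex $v$, $v$ is a downer, neutral, or Parter vertex for $\lambda$ according as the multiplicity of $\lambda$ as an eigenvalue of $G-v$ is $k-1$, $k$, or $k+1$. *)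

theory Defs
  imports
    "Graph_Theory.Pair_Digraph"
    "Jordan_Normal_Form.Char_Poly"
    "HOL-Library.Multiset"
begin

text \<open>
  As in Graph_Theory, simple graphs are modelled as finite, loop-free, symmetric digraphs
  without parallel arcs. The real spectrum of the adjacency matrix depends neither on the
  enumeration of the vertices chosen here nor on passing to the complex numbers, since for a
  symmetric digraph the adjacency matrix is real symmetric.
\<close>

definition vertex_list :: "('a, 'b) pre_digraph \<Rightarrow> 'a list" where
  "vertex_list G = (SOME vs. distinct vs \<and> set vs = verts G)"

definition adjacency_mat :: "('a, 'b) pre_digraph \<Rightarrow> real mat" where
  "adjacency_mat G = (let vs = vertex_list G in
     mat (length vs) (length vs) (\<lambda>(i, j). if vs ! i \<rightarrow>\<^bsub>G\<^esub> vs ! j then 1 else 0))"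

definition eig_mult :: "('a, 'b) pre_digraph \<Rightarrow> real \<Rightarrow> nat" where
  "eig_mult G l = order l (char_poly (adjacency_mat G))"

definition graph_spectrum :: "('a, 'b) pre_digraph \<Rightarrow> real list" where
  "graph_spectrum G = rev (sorted_list_of_multiset (proots (char_poly (adjacency_mat G))))"

text \<open>The indices of the eigenvalues of a graph on \<open>n\<close> vertices range over \<open>1, \<dots>, n\<close>.\<close>

definition graph_eig :: "('a, 'b) pre_digraph \<Rightarrow> nat \<Rightarrow> real" where
  "graph_eig G k = graph_spectrum G ! (k - 1)"

definition neutral_vertex :: "('a, 'b) pre_digraph \<Rightarrow> real \<Rightarrow> 'a \<Rightarrow> bool" where
  "neutral_vertex G l v \<longleftrightarrow>
     v \<in> verts G \<and> eig_mult G l \<ge> 1 \<and> eig_mult (pre_digraph.del_vert G v) l = eig_mult G l"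

text \<open>\<open>VU i a\<close> and \<open>VV i a\<close> are the \<open>a\<close>-th elements (counting from 0) of the cells
  \<open>U\<^sub>i\<close> and \<open>V\<^sub>i\<close>.\<close>

datatype nsg_vertex = VU nat nat | VV nat nat

definition U_cell :: "(nat \<Rightarrow> nat) \<Rightarrow> nat \<Rightarrow> nsg_vertex set" where
  "U_cell m i = VU i ` {..<m i}"

definition V_cell :: "(nat \<Rightarrow> nat) \<Rightarrow> nat \<Rightarrow> nsg_vertex set" where
  "V_cell n i = VV i ` {..<n i}"

fun nsg_adj :: "nsg_vertex \<Rightarrow> nsg_vertex \<Rightarrow> bool" where
  "nsg_adj (VU i a) (VU j b) \<longleftrightarrow> False"
| "nsg_adj (VV i a) (VV j b) \<longleftrightarrow> VV i a \<noteq> VV j b"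
| "nsg_adj (VU i a) (VV j b) \<longleftrightarrow> j \<le> i"
| "nsg_adj (VV j b) (VU i a) \<longleftrightarrow> j \<le> i"

text \<open>Only the values of \<open>m\<close> and \<open>n\<close> on \<open>{1..h}\<close> matter.\<close>

definition NSG :: "nat \<Rightarrow> (nat \<Rightarrow> nat) \<Rightarrow> (nat \<Rightarrow> nat) \<Rightarrow> nsg_vertex pair_pre_digraph" where
  "NSG h m n = (let W = (\<Union>i\<in>{1..h}. U_cell m i \<union> V_cell n i) in
     \<lparr> pverts = W, parcs = {(x, y). x \<in> W \<and> y \<in> W \<and> nsg_adj x y} \<rparr>)"

lemma nsg_adj_sym: "nsg_adj x y \<Longrightarrow> nsg_adj y x"
  by (cases x; cases y) auto

lemma nsg_adj_irrefl: "\<not> nsg_adj x x"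
  by (cases x) auto

lemma finite_pverts_NSG: "finite (pverts (NSG h m n))"
  by (simp add: NSG_def Let_def U_cell_def V_cell_def)

lemma pair_graph_NSG: "pair_graph (NSG h m n)"
proof
  have "parcs (NSG h m n) \<subseteq> pverts (NSG h m n) \<times> pverts (NSG h m n)"
    by (auto simp: NSG_def Let_def)
  then show "finite (parcs (NSG h m n))"
    by (rule finite_subset) (simp add: finite_pverts_NSG)
  show "symmetric (with_proj (NSG h m n))"
    by (auto simp: symmetric_def NSG_def Let_def sym_def nsg_adj_sym)
  show "finite (pverts (NSG h m n))"
    by (rule finite_pverts_NSG)
qed (auto simp: NSG_def Let_def nsg_adj_irrefl)

lemma card_pverts_NSG: "card (pverts (NSG h m n)) = (\<Sum>i=1..h. m i + n i)"
proof -
  have "card (pverts (NSG h m n)) = (\<Sum>i\<in>{1..h}. card (U_cell m i \<union> V_cell n i))"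
    by (simp add: NSG_def Let_def, rule card_UN_disjoint) (auto simp: U_cell_def V_cell_def)
  also have "\<dots> = (\<Sum>i=1..h. m i + n i)"
    by (intro sum.cong refl, subst card_Un_disjoint)
       (auto simp: U_cell_def V_cell_def card_image inj_on_def)
  finally show ?thesis .
qed

end

theory Submission
  imports Defs "HOL-Analysis.Function_Topology"
begin

text \<open>
  A neutral vertex \<open>u \<in> U\<^sub>s\<close> forces an eigenfunction \<open>x\<close> of \<open>G\<close> for \<open>l\<close> with \<open>x u = 0\<close>, so the
  equation at \<open>u\<close> says that \<open>x\<close> sums to zero over \<open>V\<^sub>1 \<union> \<dots> \<union> V\<^sub>s\<close>. Restricted to \<open>G''\<close>, the
  function \<open>x\<close> satisfies the eigenvalue equation on all \<open>U\<^sub>i\<close> and satisfies it up to one common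
  constant \<open>c\<close> on all \<open>V\<^sub>j\<close>; because of the zero sum its Rayleigh quotient is still \<open>l\<close>. If \<open>c\<close>
  were 0, the equations, read from cell \<open>s\<close> downwards and then upwards, would give \<open>x = 0\<close>, as
  \<open>l \<noteq> 0, -1\<close>. So \<open>l\<close> is the Rayleigh quotient on \<open>G''\<close> of a function that is not an
  eigenfunction, and hence lies strictly between the extreme eigenvalues.
\<close>

section \<open>Extreme eigenvalues of symmetric forms\<close>

text \<open>Functions on vertices need no enumeration, unlike vectors. Values outside
  \<open>V\<close> are ignored, so an eigenfunction of a graph can be used on a smaller vertex set
  without changing it.\<close>

definition eigenfunction :: "'v set \<Rightarrow> ('v \<Rightarrow> 'v \<Rightarrow> real) \<Rightarrow> real \<Rightarrow> ('v \<Rightarrow> real) \<Rightarrow> bool" where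
  "eigenfunction V a l x \<longleftrightarrow>
     (\<exists>v\<in>V. x v \<noteq> 0) \<and> (\<forall>v\<in>V. (\<Sum>w\<in>V. a v w * x w) = l * x v)"

lemma linear_coeff_zero_if_quadratic_nonneg:
  fixes b c :: real
  assumes "\<And>t. 0 \<le> b * t + c * t\<^sup>2"
  shows "b = 0"
proof (rule ccontr)
  assume b: "b \<noteq> 0"
  \<comment> \<open>A step against the sign of \<open>b\<close>, short enough for the linear term to
    dominate \<open>\<bar>c\<bar> * t\<^sup>2\<close>. The \<open>+ 1\<close> keeps the denominator
    positive when \<open>c = 0\<close>.\<close>
  define t where "t = - b / (\<bar>c\<bar> + 1)"
  have "b * t + c * t\<^sup>2 \<le> b * t + \<bar>c\<bar> * t\<^sup>2"
    by (intro add_left_mono mult_right_mono) auto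
  also have "\<dots> = - (b\<^sup>2 / (\<bar>c\<bar> + 1)\<^sup>2)"
    by (simp add: t_def power2_eq_square divide_simps) (simp add: algebra_simps)
  also have "\<dots> < 0"
    using b by simp
  finally show False
    using assms[of t] by simp
qed

text \<open>First-order optimality: perturb \<open>z\<close> in the direction of its own residual
  \<open>r\<close>. In the bound at \<open>z + t * r\<close> the constant terms cancel by attainment
  and the coefficient of \<open>t\<close> is twice the squared norm of \<open>r\<close>; a quadratic
  that is nonnegative for all \<open>t\<close> and has no constant term has no linear term either,
  so \<open>r\<close> vanishes on \<open>V\<close>.\<close>

lemma eigenequation_if_rayleigh_bound_attained:
  fixes a :: "'v \<Rightarrow> 'v \<Rightarrow> real"
  assumes sym: "\<And>v w. v \<in> V \<Longrightarrow> w \<in> V \<Longrightarrow> a v w = a w v"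
    and bound: "\<And>y. (\<Sum>v\<in>V. \<Sum>w\<in>V. a v w * y v * y w) \<le> \<mu> * (\<Sum>v\<in>V. (y v)\<^sup>2)"
    and att: "(\<Sum>v\<in>V. \<Sum>w\<in>V. a v w * z v * z w) = \<mu> * (\<Sum>v\<in>V. (z v)\<^sup>2)"
    and fin: "finite V"
    and v: "v \<in> V"
  shows "(\<Sum>w\<in>V. a v w * z w) = \<mu> * z v"
proof -
  define r where "r v = \<mu> * z v - (\<Sum>w\<in>V. a v w * z w)" for v
  define Q where "Q x y = (\<Sum>v\<in>V. \<Sum>w\<in>V. a v w * x v * y w)" for x y
  have Q_swap: "Q r z = Q z r"
    unfolding Q_def by (subst sum.swap) (auto intro!: sum.cong simp: sym mult_ac)
  have Q_r: "Q r z = \<mu> * (\<Sum>v\<in>V. r v * z v) - (\<Sum>v\<in>V. (r v)\<^sup>2)"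
  proof -
    have "(\<Sum>w\<in>V. a v w * r v * z w) = r v * (\<Sum>w\<in>V. a v w * z w)" for v
      by (simp add: sum_distrib_left mult_ac)
    moreover have "(\<Sum>w\<in>V. a v w * z w) = \<mu> * z v - r v" for v
      by (simp add: r_def)
    ultimately have "Q r z = (\<Sum>v\<in>V. r v * (\<mu> * z v - r v))"
      unfolding Q_def by simp
    then show ?thesis
      by (simp add: algebra_simps sum_subtractf sum_distrib_left power2_eq_square)
  qed
  have "0 \<le> (2 * (\<Sum>v\<in>V. (r v)\<^sup>2)) * t + (\<mu> * (\<Sum>v\<in>V. (r v)\<^sup>2) - Q r r) * t\<^sup>2" for t
  proof -
    have E: "(\<Sum>v\<in>V. \<Sum>w\<in>V. a v w * (z v + t * r v) * (z w + t * r w))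
        = Q z z + t * Q r z + t * Q z r + t\<^sup>2 * Q r r"
      unfolding Q_def by (simp add: algebra_simps sum.distrib sum_distrib_left power2_eq_square)
    have N: "(\<Sum>v\<in>V. (z v + t * r v)\<^sup>2)
        = (\<Sum>v\<in>V. (z v)\<^sup>2) + 2 * t * (\<Sum>v\<in>V. r v * z v) + t\<^sup>2 * (\<Sum>v\<in>V. (r v)\<^sup>2)"
      by (simp add: power2_eq_square algebra_simps sum.distrib sum_distrib_left)
    have "Q z z = \<mu> * (\<Sum>v\<in>V. (z v)\<^sup>2)"
      using att by (simp add: Q_def)
    moreover have "t * (\<mu> * (\<Sum>v\<in>V. r v * z v)) = t * (Q r z + (\<Sum>v\<in>V. (r v)\<^sup>2))"
      using Q_r by simp
    ultimately show ?thesis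
      using bound[of "\<lambda>v. z v + t * r v", unfolded E N] Q_swap
      by (simp add: algebra_simps)
  qed
  then have "2 * (\<Sum>v\<in>V. (r v)\<^sup>2) = 0"
    by (rule linear_coeff_zero_if_quadratic_nonneg)
  then have "r v = 0"
    using fin v by (simp add: sum_nonneg_eq_0_iff)
  then show ?thesis
    by (simp add: r_def)
qed

text \<open>The type \<open>'v\<close> may be infinite, so functions are pinned to 0 outside
  \<open>V\<close>. The sphere is then a closed subset of a product of compact sets, and Tychonoff
  applies.\<close>

lemma compact_unit_sphere_fun:
  fixes V :: "'v set"
  assumes fin: "finite V"
  shows "compact {x :: 'v \<Rightarrow> real. (\<Sum>v\<in>V. (x v)\<^sup>2) = 1 \<and> (\<forall>v. v \<notin> V \<longrightarrow> x v = 0)}"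
    (is "compact ?S")
proof -
  define C :: "'v \<Rightarrow> real set" where "C v = (if v \<in> V then {-1..1} else {0})" for v
  have "compactin (product_topology (\<lambda>_. euclidean) UNIV) (PiE UNIV C)"
    by (simp add: compactin_PiE C_def)
  then have comp: "compact (PiE UNIV C)"
    by (simp add: euclidean_product_topology)
  have "?S = PiE UNIV C \<inter> {x. (\<Sum>v\<in>V. (x v)\<^sup>2) = 1}"
  proof (intro equalityI subsetI)
    fix x :: "'v \<Rightarrow> real" assume x: "x \<in> ?S"
    have "x v \<in> C v" for v
    proof (cases "v \<in> V")
      case True
      then have "(x v)\<^sup>2 \<le> (\<Sum>v\<in>V. (x v)\<^sup>2)"
        using fin by (intro member_le_sum) auto
      then have "\<bar>x v\<bar> \<le> 1"
        using x by (simp add: abs_square_le_1)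
      then show ?thesis
        using True by (auto simp: C_def)
    next
      case False
      then show ?thesis
        using x by (auto simp: C_def)
    qed
    then show "x \<in> PiE UNIV C \<inter> {x. (\<Sum>v\<in>V. (x v)\<^sup>2) = 1}"
      using x by auto
  next
    fix x assume "x \<in> PiE UNIV C \<inter> {x. (\<Sum>v\<in>V. (x v)\<^sup>2) = 1}"
    then have "\<forall>v. x v \<in> C v" and "(\<Sum>v\<in>V. (x v)\<^sup>2) = 1"
      by (auto simp: PiE_def)
    then show "x \<in> ?S"
      by (simp add: C_def) (metis singletonD)
  qed
  moreover have "closed {x :: 'v \<Rightarrow> real. (\<Sum>v\<in>V. (x v)\<^sup>2) = 1}"
    by (intro closed_Collect_eq continuous_intros continuous_on_product_coordinates)
  ultimately show ?thesis
    using comp by (simp add: compact_Int_closed)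
qed

text \<open>The form attains its maximum on the compact unit sphere. Homogeneity extends the bound
  to all functions, and the maximizer attains it, hence is an eigenfunction.\<close>

lemma rayleigh_maximizer:
  fixes a :: "'v \<Rightarrow> 'v \<Rightarrow> real"
  assumes sym: "\<And>v w. v \<in> V \<Longrightarrow> w \<in> V \<Longrightarrow> a v w = a w v"
    and fin: "finite V" and ne: "V \<noteq> {}"
  obtains \<mu> x where "eigenfunction V a \<mu> x"
    and "\<And>y. (\<Sum>v\<in>V. \<Sum>w\<in>V. a v w * y v * y w) \<le> \<mu> * (\<Sum>v\<in>V. (y v)\<^sup>2)"
proof -
  define Q where "Q y = (\<Sum>v\<in>V. \<Sum>w\<in>V. a v w * y v * y w)" for y
  define S where "S = {x :: 'v \<Rightarrow> real. (\<Sum>v\<in>V. (x v)\<^sup>2) = 1 \<and> (\<forall>v. v \<notin> V \<longrightarrow> x v = 0)}"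
  obtain v0 where v0: "v0 \<in> V"
    using ne by auto
  have "(\<Sum>v\<in>V. (of_bool (v = v0))\<^sup>2) = (1 :: real)"
    using fin v0 by (simp add: of_bool_def if_distrib[of "\<lambda>x. x\<^sup>2"] cong: if_cong)
  then have "(\<lambda>v. of_bool (v = v0)) \<in> S"
    using v0 by (auto simp: S_def)
  then have "S \<noteq> {}"
    by blast
  moreover have "continuous_on S Q"
    unfolding Q_def
    by (intro continuous_intros continuous_on_subset[OF continuous_on_product_coordinates]) auto
  moreover have "compact S"
    unfolding S_def by (rule compact_unit_sphere_fun[OF fin])
  ultimately obtain x where x: "x \<in> S" and max: "\<And>y. y \<in> S \<Longrightarrow> Q y \<le> Q x"
    using continuous_attains_sup by metis
  have bound: "Q y \<le> Q x * (\<Sum>v\<in>V. (y v)\<^sup>2)" for y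
  proof (cases "\<forall>v\<in>V. y v = 0")
    case True
    then show ?thesis
      by (simp add: Q_def)
  next
    case False
    define N where "N = (\<Sum>v\<in>V. (y v)\<^sup>2)"
    have N: "N > 0"
      unfolding N_def using False fin by (metis sum_pos2 zero_le_power2 zero_less_power2)
    define c where "c = inverse (sqrt N)"
    have c: "c\<^sup>2 = inverse N"
      using N by (simp add: c_def power_inverse)
    \<comment> \<open>Normalizing and cutting off outside \<open>V\<close> puts \<open>y\<close> on
      the sphere; neither \<open>Q\<close> nor the norm sees values outside
      \<open>V\<close>.\<close>
    define y' where "y' v = (if v \<in> V then c * y v else 0)" for v
    have "(\<Sum>v\<in>V. (y' v)\<^sup>2) = c\<^sup>2 * N"
      by (simp add: y'_def N_def power_mult_distrib sum_distrib_left)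
    then have "y' \<in> S"
      using N c by (simp add: S_def y'_def)
    then have "Q y' \<le> Q x"
      by (rule max)
    moreover have "Q y' = c\<^sup>2 * Q y"
      by (simp add: Q_def y'_def sum_distrib_left power2_eq_square mult_ac)
    ultimately have "Q y \<le> Q x * N"
      using N c by (simp add: field_simps)
    then show ?thesis
      by (simp add: N_def)
  qed
  have "(\<Sum>w\<in>V. a v w * x w) = Q x * x v" if "v \<in> V" for v
    using bound x that fin sym unfolding Q_def S_def
    by (intro eigenequation_if_rayleigh_bound_attained) auto
  moreover have "\<exists>v\<in>V. x v \<noteq> 0"
  proof (rule ccontr)
    assume "\<not> ?thesis"
    then have "(\<Sum>v\<in>V. (x v)\<^sup>2) = 0"
      by simp
    then show False
      using x by (simp add: S_def)
  qed
  ultimately have "eigenfunction V a (Q x) x"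
    by (simp add: eigenfunction_def)
  then show ?thesis
    using that bound unfolding Q_def by blast
qed

text \<open>The maximal quotient \<open>\<mu>\<close> is at least \<open>l\<close>. If they were
  equal, \<open>z\<close> would attain the bound and satisfy the eigenvalue equation everywhere,
  contrary to its failure at \<open>v\<close>.\<close>

lemma eigenvalue_gt_rayleigh_quotient:
  fixes a :: "'v \<Rightarrow> 'v \<Rightarrow> real"
  assumes sym: "\<And>v w. v \<in> V \<Longrightarrow> w \<in> V \<Longrightarrow> a v w = a w v"
    and fin: "finite V"
    and quot: "(\<Sum>v\<in>V. \<Sum>w\<in>V. a v w * z v * z w) = l * (\<Sum>v\<in>V. (z v)\<^sup>2)"
    and v: "v \<in> V" and neq: "(\<Sum>w\<in>V. a v w * z w) \<noteq> l * z v"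
  obtains \<mu> x where "l < \<mu>" "eigenfunction V a \<mu> x"
proof -
  obtain \<mu> x where ev: "eigenfunction V a \<mu> x"
    and bound: "\<And>y. (\<Sum>v\<in>V. \<Sum>w\<in>V. a v w * y v * y w) \<le> \<mu> * (\<Sum>v\<in>V. (y v)\<^sup>2)"
  proof (rule rayleigh_maximizer[of V a])
    show "V \<noteq> {}"
      using v by auto
  qed (use sym fin in auto)
  have "\<exists>w\<in>V. z w \<noteq> 0"
    using neq v by (intro ccontr[of "\<exists>w\<in>V. z w \<noteq> 0"]) simp
  then have N: "(\<Sum>v\<in>V. (z v)\<^sup>2) > 0"
    using sum_pos2[OF fin, of _ "\<lambda>v. (z v)\<^sup>2"] by auto
  have "l \<le> \<mu>"
    using bound[of z] quot N by simp
  moreover have "l \<noteq> \<mu>"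
    using eigenequation_if_rayleigh_bound_attained[OF sym bound _ fin v, of z] quot neq by auto
  ultimately show ?thesis
    using that ev by force
qed

lemma eigenvalue_lt_rayleigh_quotient:
  fixes a :: "'v \<Rightarrow> 'v \<Rightarrow> real"
  assumes sym: "\<And>v w. v \<in> V \<Longrightarrow> w \<in> V \<Longrightarrow> a v w = a w v"
    and fin: "finite V"
    and quot: "(\<Sum>v\<in>V. \<Sum>w\<in>V. a v w * z v * z w) = l * (\<Sum>v\<in>V. (z v)\<^sup>2)"
    and v: "v \<in> V" and neq: "(\<Sum>w\<in>V. a v w * z w) \<noteq> l * z v"
  obtains \<mu> x where "\<mu> < l" "eigenfunction V a \<mu> x"
proof -
  have "(\<Sum>v\<in>V. \<Sum>w\<in>V. - a v w * z v * z w) = - l * (\<Sum>v\<in>V. (z v)\<^sup>2)"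
    using quot by (simp add: sum_negf)
  moreover have "(\<Sum>w\<in>V. - a v w * z w) \<noteq> - l * z v"
    using neq by (simp add: sum_negf)
  ultimately obtain \<mu> x where "- l < \<mu>" "eigenfunction V (\<lambda>v w. - a v w) \<mu> x"
    using eigenvalue_gt_rayleigh_quotient[of V "\<lambda>v w. - a v w" z "- l" v] sym fin v by auto
  then have "- \<mu> < l" "eigenfunction V a (- \<mu>) x"
    by (auto simp: eigenfunction_def sum_negf)
  then show ?thesis
    using that by blast
qed

text \<open>Guarantees that the sorted list of real roots has full length, so that its positions 1
  and \<open>n\<close> are meaningful. Over the complex numbers the polynomial splits; symmetry
  makes every root real, and the factorization descends because the embedding of real polynomials is
  injective.\<close>

lemma char_poly_real_symmetric_splits:
  fixes A :: "real mat"
  assumes A: "A \<in> carrier_mat n n"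
    and sym: "\<And>i j. i < n \<Longrightarrow> j < n \<Longrightarrow> A $$ (i, j) = A $$ (j, i)"
  shows "size (proots (char_poly A)) = n"
proof -
  define C where "C = map_mat complex_of_real A"
  have C: "C \<in> carrier_mat n n"
    using A by (simp add: C_def)
  obtain as where as: "char_poly C = (\<Prod>a\<leftarrow>as. [:- a, 1:])" and len: "length as = n"
    using char_poly_factorized[OF C] by auto
  have real: "complex_of_real (Re a) = a" if "a \<in> set as" for a
  proof -
    have "poly (char_poly C) a = 0"
      using that by (auto simp: as poly_prod_list)
    then obtain v where v: "v \<in> carrier_vec n" "v \<noteq> 0\<^sub>v n" "C *\<^sub>v v = a \<cdot>\<^sub>v v"
      using C by (auto simp: eigenvalue_root_char_poly[OF C, symmetric] eigenvalue_def eigenvector_def)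
    have Cv: "(\<Sum>j<n. of_real (A $$ (i, j)) * v $ j) = a * v $ i" if "i < n" for i
    proof -
      have "(C *\<^sub>v v) $ i = (\<Sum>j<n. of_real (A $$ (i, j)) * v $ j)"
        using that A v(1) by (auto simp: C_def scalar_prod_def lessThan_atLeast0 intro!: sum.cong)
      then show ?thesis
        using v that by simp
    qed
    define N where "N = (\<Sum>i<n. (cmod (v $ i))\<^sup>2)"
    \<comment> \<open>The Hermitian form of \<open>A\<close> at \<open>v\<close>: it equals
      \<open>a * of_real N\<close> by the eigenvalue equation and is real by symmetry, which forces
      \<open>a\<close> to be real.\<close>
    define q where "q = (\<Sum>i<n. \<Sum>j<n. cnj (v $ i) * of_real (A $$ (i, j)) * v $ j)"
    have "q = (\<Sum>i<n. cnj (v $ i) * (a * v $ i))"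
      unfolding q_def by (intro sum.cong refl) (simp add: Cv[symmetric] sum_distrib_left mult_ac)
    also have "\<dots> = a * of_real N"
      by (simp add: N_def sum_distrib_left complex_norm_square mult_ac del: of_real_power)
    finally have q: "q = a * of_real N" .
    have "cnj q = q"
      unfolding q_def cnj_sum
      by (subst sum.swap) (auto intro!: sum.cong simp: sym mult_ac)
    then have "cnj a * of_real N = a * of_real N"
      by (simp add: q)
    moreover have "N > 0"
    proof -
      obtain i where "i < n" "v $ i \<noteq> 0"
        using v(1,2) by (metis carrier_vecD eq_vecI index_zero_vec)
      then show ?thesis
        unfolding N_def by (intro sum_pos2[of _ i]) auto
    qed
    ultimately have "cnj a = a"
      by simp
    then show ?thesis
      by (simp add: complex_eq_iff)
  qed
  interpret of_real_poly: map_poly_inj_idom_hom complex_of_real ..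
  have "map_poly complex_of_real (char_poly A) = char_poly C"
    unfolding C_def using of_real_hom.char_poly_hom[OF A] by metis
  also have "\<dots> = (\<Prod>a\<leftarrow>as. map_poly complex_of_real [:- Re a, 1:])"
    unfolding as by (intro arg_cong[where f = prod_list] map_cong refl) (simp add: real)
  also have "\<dots> = map_poly complex_of_real (\<Prod>a\<leftarrow>as. [:- Re a, 1:])"
    by (simp add: of_real_poly.hom_prod_list o_def)
  finally have "char_poly A = (\<Prod>a\<leftarrow>as. [:- Re a, 1:])"
    by simp
  then have "proots (char_poly A) = (\<Sum>a\<leftarrow>as. {#Re a#})"
    using proots_prod_list[of "map (\<lambda>a. [:- Re a, 1:]) as"]
    by (simp add: o_def image_iff del: sum_list_singleton_mset)
  then have "proots (char_poly A) = mset (map Re as)"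
    by simp
  then show ?thesis
    using len by simp
qed

section \<open>Eigenfunctions of graphs\<close>

definition adj :: "('a, 'b) pre_digraph \<Rightarrow> 'a \<Rightarrow> 'a \<Rightarrow> real" where
  "adj G v w = of_bool (v \<rightarrow>\<^bsub>G\<^esub> w)"

lemma adj_sym: "symmetric G \<Longrightarrow> adj G v w = adj G w v"
  by (auto simp: adj_def symmetric_def dest: symD)

section \<open>Passage between adjacency matrices and functions on the vertices\<close>

lemma vertex_list:
  assumes "finite (verts G)"
  shows "distinct (vertex_list G)" "set (vertex_list G) = verts G"
    "length (vertex_list G) = card (verts G)"
proof -
  have "\<exists>vs. distinct vs \<and> set vs = verts G"
    using finite_distinct_list[OF assms] by blast
  then have "distinct (vertex_list G) \<and> set (vertex_list G) = verts G"
    unfolding vertex_list_def by (rule someI_ex)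
  then show "distinct (vertex_list G)" "set (vertex_list G) = verts G"
    "length (vertex_list G) = card (verts G)"
    using distinct_card[of "vertex_list G"] by simp_all
qed

lemma adjacency_mat_carrier:
  "finite (verts G) \<Longrightarrow> adjacency_mat G \<in> carrier_mat (card (verts G)) (card (verts G))"
  by (simp add: adjacency_mat_def Let_def vertex_list)

lemma adjacency_mat_index:
  assumes "finite (verts G)" "i < card (verts G)" "j < card (verts G)"
  shows "adjacency_mat G $$ (i, j) = adj G (vertex_list G ! i) (vertex_list G ! j)"
  using assms by (simp add: adjacency_mat_def Let_def vertex_list adj_def)

lemma sum_vertex_list:
  assumes "finite (verts G)"
  shows "(\<Sum>i<card (verts G). g (vertex_list G ! i)) = sum g (verts G)"
proof -
  have "bij_betw (nth (vertex_list G)) {..<card (verts G)} (verts G)"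
    by (rule bij_betw_nth) (simp_all add: vertex_list[OF assms])
  then show ?thesis
    by (rule sum.reindex_bij_betw)
qed

lemma adjacency_mat_mult_vec:
  assumes fin: "finite (verts G)" and y: "y \<in> carrier_vec (card (verts G))"
    and x: "\<And>i. i < card (verts G) \<Longrightarrow> y $ i = x (vertex_list G ! i)"
    and i: "i < card (verts G)"
  shows "(adjacency_mat G *\<^sub>v y) $ i = (\<Sum>w\<in>verts G. adj G (vertex_list G ! i) w * x w)"
proof -
  have "(adjacency_mat G *\<^sub>v y) $ i
      = (\<Sum>j<card (verts G). adj G (vertex_list G ! i) (vertex_list G ! j) * x (vertex_list G ! j))"
    using assms adjacency_mat_carrier[OF fin]
    by (auto simp: scalar_prod_def lessThan_atLeast0 adjacency_mat_index intro!: sum.cong)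
  then show ?thesis
    by (simp add: sum_vertex_list[OF fin, of "\<lambda>w. adj G (vertex_list G ! i) w * x w"])
qed

lemma eigenvalue_adjacency_mat_iff:
  assumes fin: "finite (verts G)"
  shows "eigenvalue (adjacency_mat G) l \<longleftrightarrow> (\<exists>x. eigenfunction (verts G) (adj G) l x)"
proof
  let ?n = "card (verts G)" and ?vs = "vertex_list G"
  note vs = vertex_list[OF fin]
  have verts_nth: "\<exists>i<?n. v = ?vs ! i" if "v \<in> verts G" for v
    using that vs by (metis in_set_conv_nth)
  have dims: "dim_row (adjacency_mat G) = ?n"
    using adjacency_mat_carrier[OF fin] by auto
  {
    assume "eigenvalue (adjacency_mat G) l"
    then obtain y where y: "y \<in> carrier_vec ?n" "y \<noteq> 0\<^sub>v ?n" "adjacency_mat G *\<^sub>v y = l \<cdot>\<^sub>v y"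
      by (auto simp: eigenvalue_def eigenvector_def dims)
    have "inj_on (nth ?vs) {..<?n}"
      using vs by (simp add: inj_on_nth)
    \<comment> \<open>The entries of \<open>y\<close> are carried to the vertices by inverting the
      enumeration, which is injective.\<close>
    define x where "x v = y $ the_inv_into {..<?n} (nth ?vs) v" for v
    have x: "y $ i = x (?vs ! i)" if "i < ?n" for i
      using that \<open>inj_on (nth ?vs) {..<?n}\<close> by (simp add: x_def the_inv_into_f_f)
    have "(\<Sum>w\<in>verts G. adj G v w * x w) = l * x v" if v: "v \<in> verts G" for v
    proof -
      obtain i where i: "i < ?n" "v = ?vs ! i"
        using verts_nth[OF v] by blast
      then show ?thesis
        using adjacency_mat_mult_vec[OF fin y(1) x i(1)] y x[OF i(1)] by simp
    qed
    moreover have "\<exists>v\<in>verts G. x v \<noteq> 0"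
    proof -
      obtain i where i: "i < ?n" "y $ i \<noteq> 0"
        using y(1,2) by (metis carrier_vecD eq_vecI index_zero_vec)
      then have "?vs ! i \<in> verts G"
        using vs nth_mem[of i ?vs] by simp
      then show ?thesis
        using x i by auto
    qed
    ultimately show "\<exists>x. eigenfunction (verts G) (adj G) l x"
      by (auto simp: eigenfunction_def)
  next
    assume "\<exists>x. eigenfunction (verts G) (adj G) l x"
    then obtain x where ex: "\<exists>v\<in>verts G. x v \<noteq> 0"
      and x: "\<And>v. v \<in> verts G \<Longrightarrow> (\<Sum>w\<in>verts G. adj G v w * x w) = l * x v"
      by (auto simp: eigenfunction_def)
    define y where "y = Matrix.vec ?n (\<lambda>i. x (?vs ! i))"
    have y: "y \<in> carrier_vec ?n" "\<And>i. i < ?n \<Longrightarrow> y $ i = x (?vs ! i)"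
      by (simp_all add: y_def)
    have "adjacency_mat G *\<^sub>v y = l \<cdot>\<^sub>v y"
    proof (rule eq_vecI)
      show "dim_vec (adjacency_mat G *\<^sub>v y) = dim_vec (l \<cdot>\<^sub>v y)"
        using y dims by simp
      fix i assume "i < dim_vec (l \<cdot>\<^sub>v y)"
      then have i: "i < ?n"
        using y by simp
      then have "?vs ! i \<in> verts G"
        using vs nth_mem[of i ?vs] by simp
      then show "(adjacency_mat G *\<^sub>v y) $ i = (l \<cdot>\<^sub>v y) $ i"
        using adjacency_mat_mult_vec[OF fin y i] i x y by simp
    qed
    moreover have "y \<noteq> 0\<^sub>v ?n"
      using ex verts_nth y by (metis index_zero_vec(1))
    ultimately show "eigenvalue (adjacency_mat G) l"
      using y by (auto simp: eigenvalue_def eigenvector_def dims)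
  }
qed

lemma eigenvalue_if_eig_mult_pos:
  assumes "finite (verts G)" "eig_mult G l \<ge> 1"
  shows "eigenvalue (adjacency_mat G) l"
  using assms(2) eigenvalue_root_char_poly[OF adjacency_mat_carrier[OF assms(1)]]
  by (metis eig_mult_def not_one_le_zero order_root)

lemma graph_eig_bounds:
  assumes fin: "finite (verts G)" and sym: "symmetric G"
    and ev: "eigenvalue (adjacency_mat G) l"
  shows "graph_eig G (card (verts G)) \<le> l" "l \<le> graph_eig G 1"
proof -
  let ?n = "card (verts G)" and ?p = "char_poly (adjacency_mat G)"
  note A = adjacency_mat_carrier[OF fin]
  define xs where "xs = sorted_list_of_multiset (proots ?p)"
  have xs: "mset xs = proots ?p" "sorted xs"
    by (simp_all add: xs_def sorted_sorted_list_of_multiset)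
  have "size (proots ?p) = ?n"
    by (intro char_poly_real_symmetric_splits[OF A])
      (simp add: adjacency_mat_index[OF fin] adj_sym[OF sym])
  then have len: "length xs = ?n"
    using xs(1) by (metis size_mset)
  have "?p \<noteq> 0"
    using degree_monic_char_poly[OF A] by auto
  then have "l \<in># proots ?p"
    using ev eigenvalue_root_char_poly[OF A] by simp
  then have "l \<in> set xs"
    using xs(1) by (metis set_mset_mset)
  then obtain i where i: "i < ?n" "xs ! i = l"
    using len by (auto simp: in_set_conv_nth)
  \<comment> \<open>\<open>graph_eig\<close> counts from 1 in non-increasing order while
    \<open>xs\<close> is ascending and counted from 0. The existence of \<open>i\<close> excludes
    \<open>?n = 0\<close>.\<close>
  have "graph_eig G ?n = xs ! 0" "graph_eig G 1 = xs ! (?n - 1)"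
    using i len by (simp_all add: graph_eig_def graph_spectrum_def xs_def[symmetric] rev_nth)
  then show "graph_eig G ?n \<le> l" "l \<le> graph_eig G 1"
    using i len xs(2) by (auto simp: sorted_iff_nth_mono)
qed

section \<open>Deletion of a vertex and vanishing eigenfunctions\<close>

lemma arcs_ends_del_vert:
  "arcs_ends (pre_digraph.del_vert G u) = {(v, w) \<in> arcs_ends G. v \<noteq> u \<and> w \<noteq> u}"
  by (auto simp: arcs_ends_def pre_digraph.del_vert_def arc_to_ends_def)

text \<open>If some eigenfunction does not vanish at \<open>u\<close>, pairing it with an eigenfunction of
  \<open>G - u\<close> extended by zero shows that the extension also satisfies the eigenvalue equation at \<open>u\<close>.\<close>

lemma eigenfunction_vanishing_at_deleted_vertex:
  assumes fin: "finite (verts G)" and sym: "symmetric G" and u: "u \<in> verts G"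
    and evG: "eigenvalue (adjacency_mat G) l"
    and evD: "eigenvalue (adjacency_mat (pre_digraph.del_vert G u)) l"
  obtains x where "eigenfunction (verts G) (adj G) l x" "x u = 0"
proof -
  let ?V = "verts G" and ?D = "pre_digraph.del_vert G u"
  obtain x where x: "eigenfunction ?V (adj G) l x"
    using evG eigenvalue_adjacency_mat_iff[OF fin] by blast
  obtain y where y: "eigenfunction (?V - {u}) (adj ?D) l y"
    using evD eigenvalue_adjacency_mat_iff[of ?D] fin by (auto simp: pre_digraph.del_vert_def)
  define z where "z = y(u := 0)"
  have z_eq: "(\<Sum>w\<in>?V. adj G v w * z w) = l * z v" if "v \<in> ?V - {u}" for v
  proof -
    have "(\<Sum>w\<in>?V. adj G v w * z w) = (\<Sum>w\<in>?V - {u}. adj ?D v w * y w)"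
      using that fin
      by (intro sum.mono_neutral_cong_right) (auto simp: z_def adj_def arcs_ends_del_vert)
    then show ?thesis
      using y that by (simp add: eigenfunction_def z_def)
  qed
  show ?thesis
  proof (cases "x u = 0")
    case True
    then show ?thesis
      using that x by blast
  next
    case False
    \<comment> \<open>Evaluated through the equation of \<open>x\<close>, this pairing has no term
      at \<open>u\<close>, since \<open>z u = 0\<close>. Comparing with the equations of
      \<open>z\<close> off \<open>u\<close> leaves only the summand at \<open>u\<close>, which must
      therefore vanish.\<close>
    have "(\<Sum>v\<in>?V. x v * (\<Sum>w\<in>?V. adj G v w * z w)) = (\<Sum>w\<in>?V. z w * (\<Sum>v\<in>?V. adj G w v * x v))"
      by (simp add: sum_distrib_left, subst sum.swap)
        (auto intro!: sum.cong simp: adj_sym[OF sym] mult_ac)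
    also have "\<dots> = (\<Sum>w\<in>?V. l * (x w * z w))"
      using x by (intro sum.cong) (auto simp: eigenfunction_def)
    also have "\<dots> = (\<Sum>w\<in>?V - {u}. l * (x w * z w))"
      using fin by (intro sum.mono_neutral_right) (auto simp: z_def)
    also have "\<dots> = (\<Sum>v\<in>?V - {u}. x v * (\<Sum>w\<in>?V. adj G v w * z w))"
      using z_eq by (intro sum.cong) auto
    finally have "x u * (\<Sum>w\<in>?V. adj G u w * z w) = 0"
      using sum.remove[OF fin u, of "\<lambda>v. x v * (\<Sum>w\<in>?V. adj G v w * z w)"] by linarith
    then have "(\<Sum>w\<in>?V. adj G u w * z w) = l * z u"
      using False by (simp add: z_def)
    then have "\<forall>v\<in>?V. (\<Sum>w\<in>?V. adj G v w * z w) = l * z v"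
      using z_eq by blast
    moreover have "\<exists>v\<in>?V. z v \<noteq> 0"
      using y by (auto simp: eigenfunction_def z_def)
    ultimately have "eigenfunction ?V (adj G) l z"
      by (simp add: eigenfunction_def)
    then show ?thesis
      using that by (simp add: z_def)
  qed
qed

section \<open>Nested split graphs\<close>

lemma verts_NSG: "pverts (NSG h m n) = (\<Union>i\<in>{1..h}. U_cell m i \<union> V_cell n i)"
  by (simp add: NSG_def Let_def)

lemma parcs_NSG:
  "(v, w) \<in> parcs (NSG h m n) \<longleftrightarrow>
     v \<in> pverts (NSG h m n) \<and> w \<in> pverts (NSG h m n) \<and> nsg_adj v w"
  by (simp add: NSG_def Let_def)

lemma VU_in_NSG: "VU i a \<in> pverts (NSG h m n) \<longleftrightarrow> 1 \<le> i \<and> i \<le> h \<and> a < m i"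
  and VV_in_NSG: "VV i b \<in> pverts (NSG h m n) \<longleftrightarrow> 1 \<le> i \<and> i \<le> h \<and> b < n i"
  by (auto simp: verts_NSG U_cell_def V_cell_def)

lemma symmetric_NSG: "symmetric (with_proj (NSG h m n))"
  by (auto simp: symmetric_def sym_def parcs_NSG nsg_adj_sym)

lemma sum_NSG:
  fixes g :: "nsg_vertex \<Rightarrow> real"
  shows "sum g (pverts (NSG h m n))
    = (\<Sum>i=1..h. \<Sum>a<m i. g (VU i a)) + (\<Sum>j=1..h. \<Sum>b<n j. g (VV j b))"
proof -
  have "sum g (pverts (NSG h m n)) = (\<Sum>i=1..h. sum g (U_cell m i \<union> V_cell n i))"
    unfolding verts_NSG by (intro sum.UNION_disjoint) (auto simp: U_cell_def V_cell_def)
  also have "\<dots> = (\<Sum>i=1..h. (\<Sum>a<m i. g (VU i a)) + (\<Sum>b<n i. g (VV i b)))"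
  proof (intro sum.cong refl)
    fix i
    have "sum g (U_cell m i \<union> V_cell n i) = sum g (U_cell m i) + sum g (V_cell n i)"
      by (intro sum.union_disjoint) (auto simp: U_cell_def V_cell_def)
    then show "sum g (U_cell m i \<union> V_cell n i) = (\<Sum>a<m i. g (VU i a)) + (\<Sum>b<n i. g (VV i b))"
      by (simp add: U_cell_def V_cell_def sum.reindex inj_on_def)
  qed
  finally show ?thesis
    by (simp add: sum.distrib)
qed

lemma adj_sum_U:
  fixes f :: "nsg_vertex \<Rightarrow> real"
  assumes "1 \<le> i" "i \<le> h" "a < m i"
  shows "(\<Sum>w\<in>pverts (NSG h m n). adj (NSG h m n) (VU i a) w * f w) = (\<Sum>j=1..i. \<Sum>b<n j. f (VV j b))"
proof -
  have "(\<Sum>w\<in>pverts (NSG h m n). adj (NSG h m n) (VU i a) w * f w)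
      = (\<Sum>w\<in>pverts (NSG h m n). of_bool (nsg_adj (VU i a) w) * f w)"
    using assms by (intro sum.cong) (auto simp: adj_def parcs_NSG VU_in_NSG)
  also have "\<dots> = (\<Sum>j=1..h. \<Sum>b<n j. of_bool (j \<le> i) * f (VV j b))"
    by (simp add: sum_NSG)
  also have "\<dots> = (\<Sum>j=1..i. \<Sum>b<n j. f (VV j b))"
    using assms by (intro sum.mono_neutral_cong_right) auto
  finally show ?thesis .
qed

lemma adj_sum_V:
  fixes f :: "nsg_vertex \<Rightarrow> real"
  assumes "1 \<le> j" "j \<le> h" "b < n j"
  shows "(\<Sum>w\<in>pverts (NSG h m n). adj (NSG h m n) (VV j b) w * f w)
    = (\<Sum>k=1..h. \<Sum>b<n k. f (VV k b)) + (\<Sum>i=j..h. \<Sum>a<m i. f (VU i a)) - f (VV j b)"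
proof -
  let ?V = "pverts (NSG h m n)"
  have "(\<Sum>w\<in>?V. adj (NSG h m n) (VV j b) w * f w)
      = (\<Sum>w\<in>?V. of_bool (nsg_adj (VV j b) w) * f w)"
    using assms by (intro sum.cong) (auto simp: adj_def parcs_NSG VV_in_NSG)
  \<comment> \<open>Counting the vertex as its own neighbour turns the clique part into full cells;
    the extra diagonal term is subtracted again.\<close>
  also have "\<dots> = (\<Sum>w\<in>?V. of_bool (nsg_adj (VV j b) w \<or> w = VV j b) * f w) - (\<Sum>w\<in>?V. of_bool (w = VV j b) * f w)"
    by (subst sum_subtractf[symmetric], intro sum.cong) (auto simp: nsg_adj_irrefl)
  also have "(\<Sum>w\<in>?V. of_bool (w = VV j b) * f w) = f (VV j b)"
    using assms by (simp add: finite_pverts_NSG VV_in_NSG of_bool_def if_distrib[of "\<lambda>x. x * _"] cong: if_cong)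
  also have "(\<Sum>w\<in>?V. of_bool (nsg_adj (VV j b) w \<or> w = VV j b) * f w)
      = (\<Sum>i=1..h. \<Sum>a<m i. of_bool (j \<le> i) * f (VU i a)) + (\<Sum>k=1..h. \<Sum>b<n k. f (VV k b))"
    unfolding sum_NSG by (intro arg_cong2[of _ _ _ _ "(+)"] sum.cong) auto
  also have "(\<Sum>i=1..h. \<Sum>a<m i. of_bool (j \<le> i) * f (VU i a)) = (\<Sum>i=j..h. \<Sum>a<m i. f (VU i a))"
    using assms by (intro sum.mono_neutral_cong_right) auto
  finally show ?thesis
    by simp
qed

text \<open>\<open>c\<close> is what a vertex of \<open>V\<^sub>j\<close> with \<open>j \<le> s\<close> sees outside the smaller graph.\<close>

context
  fixes h s :: nat and m n :: "nat \<Rightarrow> nat" and l :: real and x :: "nsg_vertex \<Rightarrow> real"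
    and A B :: "nat \<Rightarrow> real" and c :: real
  defines "A i \<equiv> \<Sum>a<m i. x (VU i a)"
    and "B j \<equiv> \<Sum>b<n j. x (VV j b)"
    and "c \<equiv> (\<Sum>j=s+1..h. B j) + (\<Sum>i=s+1..h. A i)"
  assumes s: "1 \<le> s" "s \<le> h"
    and ev: "eigenfunction (pverts (NSG h m n)) (adj (NSG h m n)) l x"
    and nz: "l \<noteq> 0" "l \<noteq> -1"
    and ms: "m s > 0" and xs: "x (VU s 0) = 0"
begin

section \<open>Vanishing of the eigenfunction when \<open>c = 0\<close>\<close>

lemma U_equation: "(\<Sum>j=1..i. B j) = l * x (VU i a)"
  if "1 \<le> i" "i \<le> h" "a < m i" for i a
  using ev that adj_sum_U[of i h a m n x]
  by (simp add: eigenfunction_def VU_in_NSG B_def)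

text \<open>A vertex of the clique is missing from its own neighbourhood; moving that term to the
  right turns \<open>l\<close> into \<open>l + 1\<close>. Hence \<open>l \<noteq> -1\<close> is what
  makes a zero left side force zero values.\<close>

lemma V_equation: "(\<Sum>k=1..h. B k) + (\<Sum>i=j..h. A i) = (l + 1) * x (VV j b)"
  if "1 \<le> j" "j \<le> h" "b < n j" for j b
  using ev that adj_sum_V[of j h b n m x]
  by (simp add: eigenfunction_def VV_in_NSG A_def B_def algebra_simps)

lemma sum_B_s: "(\<Sum>j=1..s. B j) = 0"
  using U_equation[of s 0] s ms xs by simp

lemma sum_B_h: "(\<Sum>j=1..h. B j) = (\<Sum>j=s+1..h. B j)"
  using s sum_B_s sum.ub_add_nat[of 1 s B "h - s"] by simp

text \<open>Induction downwards from \<open>s\<close>. With the cells between \<open>j\<close> and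
  \<open>s\<close> zero, the partial sum of \<open>B\<close> up to \<open>j\<close> equals the full
  sum up to \<open>s\<close>, which is 0, so \<open>U_j\<close> vanishes. Then the left side of
  \<open>V_equation\<close> for \<open>j\<close> reduces to \<open>c = 0\<close>, so
  \<open>V_j\<close> vanishes.\<close>

lemma cells_zero_below:
  assumes c: "c = 0" and j: "1 \<le> j" "j \<le> s"
  shows "(\<forall>a<m j. x (VU j a) = 0) \<and> (\<forall>b<n j. x (VV j b) = 0)"
  using j
proof (induction "s - j" arbitrary: j rule: less_induct)
  case less
  have zero: "A i = 0 \<and> B i = 0" if "i \<in> {j+1..s}" for i
  proof -
    have "s - i < s - j" "1 \<le> i" "i \<le> s"
      using that less.prems by auto
    then show ?thesis
      using less.hyps[of i] by (simp add: A_def B_def)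
  qed
  have "(\<Sum>k=1..s. B k) = (\<Sum>k=1..j. B k) + (\<Sum>k=j+1..s. B k)"
    using less.prems sum.ub_add_nat[of 1 j B "s - j"] by simp
  then have "(\<Sum>k=1..j. B k) = 0"
    using zero sum_B_s by simp
  then have U: "\<forall>a<m j. x (VU j a) = 0"
    using U_equation[of j] less.prems s nz by auto
  have "(\<Sum>i=j..h. A i) = A j + (\<Sum>i=j+1..s. A i) + (\<Sum>i=s+1..h. A i)"
    using less.prems s sum.atLeast_Suc_atMost[of j h A] sum.ub_add_nat[of "j + 1" s A "h - s"] by simp
  then have "(\<Sum>i=j..h. A i) = (\<Sum>i=s+1..h. A i)"
    using zero U by (simp add: A_def)
  then have "(\<Sum>k=1..h. B k) + (\<Sum>i=j..h. A i) = 0"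
    using c sum_B_h by (simp add: c_def)
  then have "\<forall>b<n j. x (VV j b) = 0"
    using V_equation[of j] less.prems s nz by auto
  with U show ?case ..
qed

text \<open>Above \<open>s\<close> the induction runs upwards and the roles are exchanged. The cells
  between \<open>s\<close> and \<open>j\<close> contribute nothing, so the left side of
  \<open>V_equation\<close> is again \<open>c = 0\<close> and \<open>V_j\<close> vanishes first;
  then all \<open>B\<close> up to \<open>j\<close> are zero, and \<open>U_equation\<close> settles
  \<open>U_j\<close>.\<close>

lemma cells_zero:
  assumes c: "c = 0" and j: "1 \<le> j" "j \<le> h"
  shows "(\<forall>a<m j. x (VU j a) = 0) \<and> (\<forall>b<n j. x (VV j b) = 0)"
  using j
proof (induction j rule: less_induct)
  case (less j)
  show ?case
  proof (cases "j \<le> s")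
    case True
    then show ?thesis
      using cells_zero_below[OF c] less.prems by blast
  next
    case False
    have zero: "A i = 0 \<and> B i = 0" if "1 \<le> i" "i < j" for i
      using less.IH[of i] less.prems that by (simp add: A_def B_def)
    have "(\<Sum>i=s+1..h. A i) = (\<Sum>i=s+1..j-1. A i) + (\<Sum>i=j..h. A i)"
      using False less.prems sum.ub_add_nat[of "s + 1" "j - 1" A "h - (j - 1)"] by simp
    moreover have "(\<Sum>i=s+1..j-1. A i) = 0"
      using zero by (intro sum.neutral) auto
    ultimately have "(\<Sum>i=j..h. A i) = (\<Sum>i=s+1..h. A i)"
      by simp
    then have "(\<Sum>k=1..h. B k) + (\<Sum>i=j..h. A i) = 0"
      using c sum_B_h by (simp add: c_def)
    then have V: "\<forall>b<n j. x (VV j b) = 0"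
      using V_equation[of j] less.prems nz by auto
    then have "B j = 0"
      by (simp add: B_def)
    then have "(\<Sum>k=1..j. B k) = 0"
      using zero by (intro sum.neutral) (metis atLeastAtMost_iff le_neq_implies_less)
    then have "\<forall>a<m j. x (VU j a) = 0"
      using U_equation[of j] less.prems nz by auto
    with V show ?thesis
      by blast
  qed
qed

lemma outer_contribution_nonzero: "c \<noteq> 0"
proof
  assume c: "c = 0"
  have "x v = 0" if "v \<in> pverts (NSG h m n)" for v
    using that cells_zero[OF c] by (cases v) (auto simp: VU_in_NSG VV_in_NSG)
  then show False
    using ev by (auto simp: eigenfunction_def)
qed

section \<open>Restriction to the smaller graph\<close>

lemma sub_U_equation:
  "(\<Sum>w\<in>pverts (NSG s m n). adj (NSG s m n) (VU i a) w * x w) = l * x (VU i a)"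
  if "1 \<le> i" "i \<le> s" "a < m i" for i a
  using that s adj_sum_U[of i s a m n x] U_equation[of i a] by (simp add: B_def)

lemma sub_V_equation:
  "(\<Sum>w\<in>pverts (NSG s m n). adj (NSG s m n) (VV j b) w * x w) = l * x (VV j b) - c"
  if "1 \<le> j" "j \<le> s" "b < n j" for j b
proof -
  have "(\<Sum>i=j..h. A i) = (\<Sum>i=j..s. A i) + (\<Sum>i=s+1..h. A i)"
    using that s sum.ub_add_nat[of j s A "h - s"] by simp
  then show ?thesis
    using that s adj_sum_V[of j s b n m x] V_equation[of j b] sum_B_s sum_B_h
    by (simp add: A_def[symmetric] B_def[symmetric] c_def algebra_simps)
qed

lemma sub_rayleigh_quotient:
  "(\<Sum>v\<in>pverts (NSG s m n). \<Sum>w\<in>pverts (NSG s m n). adj (NSG s m n) v w * x v * x w)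
    = l * (\<Sum>v\<in>pverts (NSG s m n). (x v)\<^sup>2)"
proof -
  let ?W = "pverts (NSG s m n)"
  have "(\<Sum>v\<in>?W. \<Sum>w\<in>?W. adj (NSG s m n) v w * x v * x w)
      = (\<Sum>v\<in>?W. x v * (\<Sum>w\<in>?W. adj (NSG s m n) v w * x w))"
    by (simp add: sum_distrib_left mult_ac)
  also have "\<dots> = (\<Sum>i=1..s. \<Sum>a<m i. x (VU i a) * (l * x (VU i a)))
      + (\<Sum>j=1..s. \<Sum>b<n j. x (VV j b) * (l * x (VV j b) - c))"
    unfolding sum_NSG[of "\<lambda>v. x v * (\<Sum>w\<in>?W. adj (NSG s m n) v w * x w)"]
    by (intro arg_cong2[of _ _ _ _ "(+)"] sum.cong refl)
      (simp_all add: sub_U_equation sub_V_equation)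
  \<comment> \<open>The defect \<open>- c\<close> is constant on the clique part and absent
    elsewhere, so pairing it with \<open>x\<close> yields a multiple of the sum that vanishes by
    \<open>sum_B_s\<close>.\<close>
  also have "\<dots> = l * (\<Sum>v\<in>?W. (x v)\<^sup>2) - c * (\<Sum>j=1..s. B j)"
    by (simp add: sum_NSG B_def sum_subtractf sum_distrib_left power2_eq_square algebra_simps)
  finally show ?thesis
    using sum_B_s by simp
qed

end

theorem theorem2p11:
  fixes h s :: nat and m n :: "nat \<Rightarrow> nat" and l :: real
  assumes "h \<ge> 1"
    and "\<And>i. i \<in> {1..h} \<Longrightarrow> m i > 0"
    and "\<And>i. i \<in> {1..h} \<Longrightarrow> n i > 0"
    and "s \<in> {1..h}"
    and "eigenvalue (adjacency_mat (with_proj (NSG h m n))) l"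
    and "l \<noteq> 0" and "l \<noteq> -1"
    and "\<forall>u\<in>U_cell m s. neutral_vertex (with_proj (NSG h m n)) l u"
  shows "graph_eig (with_proj (NSG s m n)) (\<Sum>i=1..s. m i + n i) < l
    \<and> l < graph_eig (with_proj (NSG s m n)) 1"
proof -
  let ?G = "with_proj (NSG h m n)" and ?H = "with_proj (NSG s m n)"
  have s: "1 \<le> s" "s \<le> h" and ms: "m s > 0" and n1: "n 1 > 0"
    using assms by auto
  have fin: "finite (verts ?G)" "finite (verts ?H)"
    by (simp_all add: finite_pverts_NSG)
  have "neutral_vertex ?G l (VU s 0)"
    using assms(8) ms by (simp add: U_cell_def)
  \<comment> \<open>Neutrality keeps the multiplicity of \<open>l\<close>, which is at least 1, so
    \<open>l\<close> is still an eigenvalue after the deletion.\<close>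
  then have "VU s 0 \<in> verts ?G" "eig_mult (pre_digraph.del_vert ?G (VU s 0)) l \<ge> 1"
    by (auto simp: neutral_vertex_def)
  moreover from this have "eigenvalue (adjacency_mat (pre_digraph.del_vert ?G (VU s 0))) l"
    using fin by (intro eigenvalue_if_eig_mult_pos) (simp_all add: pre_digraph.del_vert_def)
  ultimately obtain x where x: "eigenfunction (verts ?G) (adj ?G) l x" "x (VU s 0) = 0"
    using eigenfunction_vanishing_at_deleted_vertex[OF fin(1) symmetric_NSG] assms(5) by blast
  note ctxt = s x(1)[unfolded with_proj_simps] assms(6,7) ms x(2)
  \<comment> \<open>A vertex of the smaller clique, where the nonzero defect \<open>c\<close> shows
    that \<open>x\<close> is not an eigenfunction of \<open>?H\<close> for \<open>l\<close>.\<close>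
  have v: "VV 1 0 \<in> verts ?H"
    using s n1 by (simp add: VV_in_NSG)
  have neq: "(\<Sum>w\<in>verts ?H. adj ?H (VV 1 0) w * x w) \<noteq> l * x (VV 1 0)"
    using sub_V_equation[OF ctxt, of 1 0] outer_contribution_nonzero[OF ctxt] s n1 by simp
  have quot: "(\<Sum>v\<in>verts ?H. \<Sum>w\<in>verts ?H. adj ?H v w * x v * x w) = l * (\<Sum>v\<in>verts ?H. (x v)\<^sup>2)"
    using sub_rayleigh_quotient[OF ctxt] by simp
  note rayleigh = adj_sym[OF symmetric_NSG] fin(2) quot v neq
  obtain \<mu> y where \<mu>: "l < \<mu>" "eigenfunction (verts ?H) (adj ?H) \<mu> y"
    using eigenvalue_gt_rayleigh_quotient[OF rayleigh] by blast
  obtain \<nu> z where \<nu>: "\<nu> < l" "eigenfunction (verts ?H) (adj ?H) \<nu> z"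
    using eigenvalue_lt_rayleigh_quotient[OF rayleigh] by blast
  have "\<mu> \<le> graph_eig ?H 1" "graph_eig ?H (card (verts ?H)) \<le> \<nu>"
    using \<mu>(2) \<nu>(2) eigenvalue_adjacency_mat_iff[OF fin(2)]
      graph_eig_bounds[OF fin(2) symmetric_NSG] by blast+
  then show ?thesis
    \<comment> \<open>\<open>card_pverts_NSG\<close> identifies the index of the smallest eigenvalue
      with the sum of the cell sizes.\<close>
    using \<mu>(1) \<nu>(1) by (simp add: card_pverts_NSG)
qed

end
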